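(* Let $T$ be a tree and let $C$ be a configuration of guards on $T$ consisting of at most $\gamma_m^\infty(T) - 1$ guards. Then the attacker can win the m-eternal domination game on $T$ against the starting configuration $C$ in at most $\mathrm{diam}(T)$ steps (attacks), where $\mathrm{diam}(T)$ is the diameter of $T$. That is, there is an attacking strategy such that, whatever the defender does, some attack among the first $\mathrm{diam}(T)$ attacks is not defended.
   Context: The m-eternal domination game on a graph $G$: the defender places guards on vertices of $G$, at most one guard per vertex (a configuration is thus a subset of $V(G)$). In each turn, the attacker chooses a vertex to attack; the defender must then move some or all of his guards, each along at most one incident edge (or staying put), so that afterwards a guard occupies the attacked vertex and every vertex still holds at most one guard. If after the defender's response the attacked vertex is not occupied, the attacker wins; the defender wins if he can defend forever. An m-eternal dominating set is a starting configuration from which the defender can defend forever; $\gamma_m^\infty(G)$ denotes the minimum size of an m-eternal dominating set of $G$.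
   Formalization: The tree is assumed to have at least two vertices; for the one-vertex tree the diameter is 0 and the eternal domination number is 1, so with no guards the attacker needs one attack and the claim fails. *)

theory Defs
  imports "Graph_Theory.Graph_Theory"
begin

text \<open>
  Finite simple undirected graphs are the symmetric digraphs of the locale \<^locale>\<open>graph\<close>.
  There a walk \<open>a, b, a\<close> already counts as a \<^const>\<open>pre_digraph.cycle\<close>, so the library's
  \<^const>\<open>tree\<close> is not the undirected notion; the undirected cycles of a simple graph are
  exactly the cycles of length at least 3.
  \<^const>\<open>connected\<close> includes non-emptiness.
\<close>

definition undirected_tree :: "('a, 'b) pre_digraph \<Rightarrow> bool" where
  "undirected_tree G \<longleftrightarrow>
     graph G \<and> connected G \<and> \<not> (\<exists>p. pre_digraph.cycle G p \<and> 3 \<le> length p)"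

definition graph_dist :: "('a, 'b) pre_digraph \<Rightarrow> 'a \<Rightarrow> 'a \<Rightarrow> nat" where
  "graph_dist G u v = (LEAST n. \<exists>p. pre_digraph.awalk G u p v \<and> length p = n)"

definition graph_diam :: "('a, 'b) pre_digraph \<Rightarrow> nat" where
  "graph_diam G = Max {graph_dist G u v | u v. u \<in> verts G \<and> v \<in> verts G}"

definition guard_move :: "('a, 'b) pre_digraph \<Rightarrow> 'a set \<Rightarrow> 'a set \<Rightarrow> bool" where
  "guard_move G C C' \<longleftrightarrow>
     (\<exists>f. inj_on f C \<and> f ` C = C' \<and> (\<forall>g\<in>C. f g = g \<or> g \<rightarrow>\<^bsub>G\<^esub> f g))"

text \<open>
  A defender strategy \<open>\<tau>\<close> maps the list of attacks made so far (oldest first) to the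
  configuration after the response to the last of them.
\<close>

definition m_eternal_dominating :: "('a, 'b) pre_digraph \<Rightarrow> 'a set \<Rightarrow> bool" where
  "m_eternal_dominating G C \<longleftrightarrow> C \<subseteq> verts G \<and>
     (\<exists>\<tau> :: 'a list \<Rightarrow> 'a set. \<tau> [] = C \<and>
       (\<forall>as \<in> lists (verts G). \<forall>v \<in> verts G.
          guard_move G (\<tau> as) (\<tau> (as @ [v])) \<and> v \<in> \<tau> (as @ [v])))"

definition m_eternal_domination_number :: "('a, 'b) pre_digraph \<Rightarrow> nat" where
  "m_eternal_domination_number G = (LEAST k. \<exists>C. m_eternal_dominating G C \<and> card C = k)"

text \<open>
  An attacker strategy \<open>\<sigma>\<close> maps the list of configurations seen so far (oldest first, including
  the starting one) to the next attacked vertex. In a play, \<open>D i\<close> is the configuration after \<open>i\<close>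
  turns, so attack number \<open>i + 1\<close> is \<open>\<sigma> [D 0, ..., D i]\<close> and it is defended iff it lies in
  \<open>D (i + 1)\<close>.
\<close>

definition attacker_wins_within :: "('a, 'b) pre_digraph \<Rightarrow> 'a set \<Rightarrow> nat \<Rightarrow> bool" where
  "attacker_wins_within G C n \<longleftrightarrow>
     (\<exists>\<sigma> :: 'a set list \<Rightarrow> 'a. (\<forall>h. \<sigma> h \<in> verts G) \<and>
       (\<forall>D :: nat \<Rightarrow> 'a set. D 0 = C \<and> (\<forall>i<n. guard_move G (D i) (D (Suc i))) \<longrightarrow>
          (\<exists>i<n. \<sigma> (map D [0..<Suc i]) \<notin> D (Suc i))))"

end

theory Submission
  imports Defs
begin

text \<open>
  Root the tree at a leaf \<open>r\<close> and call a vertex loose unless exactly one of its children is loose.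
  Let \<open>W\<close> be the set of vertices with a loose child. The defender can hold the tree with the guard
  set \<open>W \<union> {r}\<close>: vertices with at least two loose children always keep a guard, the remaining
  vertices fall into colonies joined through such vertices, and one guard per colony suffices,
  because it can be exchanged with any vertex of its colony by shifting all guards on a path.

  Conversely, let the excess of a subtree be its number of guards minus its number of vertices
  in \<open>W\<close>. By induction from the leaves, the attacker wins within the height of the subtree if the
  excess is negative, and also if the excess is \<open>\<le> 0\<close>, the top of the subtree is loose, and a
  suitable vertex has just been defended. The point is that guards enter a subtree only through
  its parent vertex, so an attack inside a child's subtree cannot raise its excess while the
  parent is unguarded. With fewer than \<open>card (W \<union> {r})\<close> guards this yields a win within the depth
  of the tree. Rooting at a leaf saves the one extra attack needed when \<open>r\<close> is loose: then \<open>r\<close> has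
  no loose child, and attacking \<open>r\<close> makes the excess below its only child negative.
\<close>

section \<open>The attacker's forced wins\<close>

text \<open>Backward induction on positions replaces strategies and histories. An attack that no
  reply can meet makes the inner condition vacuous, hence \<open>False\<close> when no turns are
  left.\<close>

fun forced_win :: "('a, 'b) pre_digraph \<Rightarrow> nat \<Rightarrow> 'a set \<Rightarrow> bool" where
  "forced_win G 0 C = False"
| "forced_win G (Suc n) C =
     (\<exists>a\<in>verts G. \<forall>C'. guard_move G C C' \<and> a \<in> C' \<longrightarrow> forced_win G n C')"

lemma forced_win_Suc: "forced_win G n C \<Longrightarrow> forced_win G (Suc n) C"
proof (induction n arbitrary: C)
  case (Suc n)
  then show ?case by (metis forced_win.simps(2))
qed simp

lemma forced_win_mono: "forced_win G m C \<Longrightarrow> m \<le> n \<Longrightarrow> forced_win G n C"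
  by (induction n) (auto simp: le_Suc_eq simp del: forced_win.simps dest: forced_win_Suc)

lemma attacker_wins_within_if_forced_win:
  assumes "forced_win G n C"
  shows "attacker_wins_within G C n"
proof -
  define good where "good k C a \<longleftrightarrow>
    a \<in> verts G \<and> (\<forall>C'. guard_move G C C' \<and> a \<in> C' \<longrightarrow> forced_win G k C')" for k C a
  obtain a0 where a0: "a0 \<in> verts G"
    using assms by (cases n) auto
  \<comment> \<open>A history contains the starting configuration, so \<open>n - length h\<close>
    turns remain after the next attack. The default \<open>a0\<close> keeps all values of the
    strategy inside \<open>verts G\<close>.\<close>
  define \<sigma> where "\<sigma> h = (if \<exists>a. good (n - length h) (last h) a
    then SOME a. good (n - length h) (last h) a else a0)" for h
  have good_\<sigma>: "good (n - length h) (last h) (\<sigma> h)" if "good (n - length h) (last h) a" for h a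
    using that someI[of "good (n - length h) (last h)" a] unfolding \<sigma>_def by auto
  have \<sigma>_verts: "\<sigma> h \<in> verts G" for h
    using good_\<sigma>[of h] a0 by (cases "\<exists>a. good (n - length h) (last h) a") (auto simp: good_def \<sigma>_def)
  have "\<exists>i<n. \<sigma> (map D [0..<Suc i]) \<notin> D (Suc i)"
    if D0: "D 0 = C" and D: "\<forall>i<n. guard_move G (D i) (D (Suc i))" for D
  proof (rule ccontr)
    assume "\<not> ?thesis"
    then have def: "\<sigma> (map D [0..<Suc i]) \<in> D (Suc i)" if "i < n" for i
      using that by blast
    \<comment> \<open>If every attack were met, the position would stay winning with one turn fewer
      each time, down to \<open>forced_win G 0\<close>.\<close>
    have "i \<le> n \<Longrightarrow> forced_win G (n - i) (D i)" for i
    proof (induction i)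
      case (Suc i)
      let ?h = "map D [0..<Suc i]"
      have "forced_win G (Suc (n - Suc i)) (D i)"
        using Suc by (simp add: Suc_diff_Suc del: forced_win.simps)
      then obtain a where "good (n - length ?h) (last ?h) a"
        by (auto simp: good_def)
      from good_\<sigma>[OF this] have "good (n - Suc i) (D i) (\<sigma> ?h)"
        by simp
      then show ?case
        using D def[of i] Suc.prems by (auto simp: good_def)
    qed (use assms D0 in simp)
    from this[of n] show False by simp
  qed
  with \<sigma>_verts show ?thesis
    unfolding attacker_wins_within_def by blast
qed

section \<open>Moving guards along a path\<close>

lemma guard_move_card: "guard_move G C C' \<Longrightarrow> card C' = card C"
  by (auto simp: guard_move_def card_image)

lemma guard_move_refl: "guard_move G C C"
  unfolding guard_move_def by (rule exI[of _ id]) auto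

lemma guard_move_subset_verts:
  assumes "wf_digraph G" "guard_move G C C'" "C \<subseteq> verts G"
  shows "C' \<subseteq> verts G"
  using assms wf_digraph.adj_in_verts(2)[OF assms(1)] unfolding guard_move_def by (metis image_subsetI subsetD)

text \<open>The two starting sets are disjoint, and so are the two target sets, but a guard of one
  group may enter a vertex that the other group leaves in the same turn.\<close>

lemma guard_move_Un:
  assumes "guard_move G A A'" "guard_move G B B'" "A \<inter> B = {}" "A' \<inter> B' = {}"
  shows "guard_move G (A \<union> B) (A' \<union> B')"
proof -
  obtain f g where f: "bij_betw f A A'" "\<forall>x\<in>A. f x = x \<or> x \<rightarrow>\<^bsub>G\<^esub> f x"
    and g: "bij_betw g B B'" "\<forall>x\<in>B. g x = x \<or> x \<rightarrow>\<^bsub>G\<^esub> g x"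
    using assms(1,2) unfolding guard_move_def bij_betw_def by blast
  have "bij_betw (\<lambda>x. if x \<in> A then f x else g x) (A \<union> B) (A' \<union> B')"
    using f(1) g(1) assms(3,4) by (rule bij_betw_disjoint_Un)
  with f(2) g(2) show ?thesis
    unfolding guard_move_def bij_betw_def
    by (intro exI[of _ "\<lambda>x. if x \<in> A then f x else g x"]) auto
qed

text \<open>All guards on the path step forward at once, each into a vertex being vacated or into
  the free last one.\<close>

lemma guard_move_path:
  assumes "successively (\<lambda>a b. a \<rightarrow>\<^bsub>G\<^esub> b) xs" "distinct xs" "xs \<noteq> []"
  shows "guard_move G (set (butlast xs)) (set (tl xs))"
  using assms
proof (induction xs rule: induct_list012)
  case (3 a b xs)
  have "guard_move G {a} {b}"
    using 3(3) unfolding guard_move_def by (intro exI[of _ "\<lambda>_. b"]) auto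
  moreover have "guard_move G (set (butlast (b # xs))) (set xs)"
    using 3 by simp
  ultimately have "guard_move G ({a} \<union> set (butlast (b # xs))) ({b} \<union> set xs)"
    using 3(4) in_set_butlastD[of a "b # xs"] by (intro guard_move_Un) auto
  then show ?case by simp
qed (auto simp: guard_move_refl)

lemma rtranclp_imp_distinct_path:
  assumes "R\<^sup>*\<^sup>* x y"
  shows "\<exists>xs. xs \<noteq> [] \<and> distinct xs \<and> hd xs = x \<and> last xs = y \<and> successively R xs"
  using assms
proof induction
  case base
  show ?case by (rule exI[of _ "[x]"]) simp
next
  case (step y z)
  then obtain xs where xs: "xs \<noteq> []" "distinct xs" "hd xs = x" "last xs = y" "successively R xs"
    by blast
  show ?case
  proof (cases "z \<in> set xs")
    case True
    then obtain us vs where "xs = us @ z # vs" by (meson split_list)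
    with xs show ?thesis
      by (intro exI[of _ "us @ [z]"]) (auto simp: successively_append_iff hd_append)
  next
    case False
    with xs step(2) show ?thesis
      by (intro exI[of _ "xs @ [z]"]) (auto simp: successively_append_iff)
  qed
qed

lemma successively_set_butlast: "successively (\<lambda>a b. P a) xs \<Longrightarrow> set (butlast xs) \<subseteq> Collect P"
  by (induction xs rule: induct_list012) auto

lemma successively_set_tl: "successively (\<lambda>a b. P b) xs \<Longrightarrow> set (tl xs) \<subseteq> Collect P"
  by (induction xs rule: induct_list012) auto

text \<open>Along a simple path from \<open>x\<close> to \<open>y\<close>, every vertex but the last
  is occupied before the turn and every vertex but the first after it. Shifting along the path thus
  exchanges \<open>x\<close> for \<open>y\<close>, while the guards off the path stay.\<close>

lemma guard_move_shift:
  assumes path: "(\<lambda>a b. a \<rightarrow>\<^bsub>G\<^esub> b \<and> a \<in> insert x I \<and> b \<in> insert y I)\<^sup>*\<^sup>* x y"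
    and "x \<notin> I" "y \<notin> I"
  shows "guard_move G (insert x I) (insert y I)"
proof (cases "x = y")
  case False
  obtain xs where xs: "xs \<noteq> []" "distinct xs" "hd xs = x" "last xs = y"
    and succ: "successively (\<lambda>a b. a \<rightarrow>\<^bsub>G\<^esub> b \<and> a \<in> insert x I \<and> b \<in> insert y I) xs"
    using rtranclp_imp_distinct_path[OF path] by blast
  have "successively (\<lambda>a b. a \<rightarrow>\<^bsub>G\<^esub> b) xs"
    by (rule successively_mono[OF succ]) auto
  then have move: "guard_move G (set (butlast xs)) (set (tl xs))"
    using xs by (intro guard_move_path)
  have "set (butlast xs) \<subseteq> {a. a \<in> insert x I}"
    by (rule successively_set_butlast, rule successively_mono[OF succ]) auto
  moreover have "set (tl xs) \<subseteq> {b. b \<in> insert y I}"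
    by (rule successively_set_tl, rule successively_mono[OF succ]) auto
  moreover have "set xs = insert x (set (tl xs))" "x \<notin> set (tl xs)"
    using xs by (cases xs; auto)+
  moreover have "set xs = insert y (set (butlast xs))" "y \<notin> set (butlast xs)"
    using xs by (cases xs rule: rev_cases; auto)+
  ultimately have "insert x I = set (butlast xs) \<union> (I - set xs)"
    "insert y I = set (tl xs) \<union> (I - set xs)"
    and disj: "set (butlast xs) \<inter> (I - set xs) = {}" "set (tl xs) \<inter> (I - set xs) = {}"
    using False assms(2,3) by auto
  then show ?thesis
    using guard_move_Un[OF move guard_move_refl disj] by simp
qed (simp add: guard_move_refl)

section \<open>Trees rooted at a leaf\<close>

text \<open>The tree is given by parent pointers; \<open>adj_cases\<close> leaves no edges besides
  those to parents and so stands in for acyclicity.\<close>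

locale leaf_rooted_tree = graph G for G :: "('a, 'b) pre_digraph" (structure) +
  fixes r :: 'a and par :: "'a \<Rightarrow> 'a" and depth :: "'a \<Rightarrow> nat"
  assumes root_in_verts: "r \<in> verts G"
    and par_adj: "\<And>v. v \<in> verts G \<Longrightarrow> v \<noteq> r \<Longrightarrow> v \<rightarrow>\<^bsub>G\<^esub> par v"
    and depth_par: "\<And>v. v \<in> verts G \<Longrightarrow> v \<noteq> r \<Longrightarrow> depth v = Suc (depth (par v))"
    and adj_cases: "\<And>u v. u \<rightarrow>\<^bsub>G\<^esub> v \<Longrightarrow> u \<noteq> r \<and> par u = v \<or> v \<noteq> r \<and> par v = u"
    and root_leaf: "\<And>u v. r \<rightarrow>\<^bsub>G\<^esub> u \<Longrightarrow> r \<rightarrow>\<^bsub>G\<^esub> v \<Longrightarrow> u = v"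
begin

lemma par_in_verts: "v \<in> verts G \<Longrightarrow> v \<noteq> r \<Longrightarrow> par v \<in> verts G"
  using par_adj adj_in_verts(2) by blast

definition children :: "'a \<Rightarrow> 'a set" where
  "children v = {c \<in> verts G. c \<noteq> r \<and> par c = v}"

definition height :: nat where
  "height = Max (depth ` verts G)"

inductive_set subtree :: "'a \<Rightarrow> 'a set" for v where
  root: "v \<in> subtree v"
| child: "u \<in> verts G \<Longrightarrow> u \<noteq> r \<Longrightarrow> par u \<in> subtree v \<Longrightarrow> u \<in> subtree v"

lemma finite_children [simp]: "finite (children v)"
  by (simp add: children_def)

lemma children_in_verts: "c \<in> children v \<Longrightarrow> c \<in> verts G"
  by (simp add: children_def)

lemma depth_le_height: "v \<in> verts G \<Longrightarrow> depth v \<le> height"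
  by (simp add: height_def)

lemma depth_child: "c \<in> children v \<Longrightarrow> depth c = Suc (depth v)"
  using depth_par by (auto simp: children_def)

lemma root_children_unique: "c \<in> children r \<Longrightarrow> d \<in> children r \<Longrightarrow> c = d"
  using par_adj graph_symmetric root_leaf unfolding children_def
  by (metis (mono_tags, lifting) mem_Collect_eq)

text \<open>Depth is bounded by \<open>height\<close>, so descending terminates. Both the recursion
  for \<open>loose\<close> and the attacker's induction from the leaves rest on this.\<close>

lemma wf_children: "wf {(c, v). c \<in> children v}"
proof (rule wf_subset)
  show "{(c, v). c \<in> children v} \<subseteq> measure (\<lambda>v. height - depth v)"
    using depth_child depth_le_height children_in_verts by fastforce
qed simp

lemma subtree_depth: "u \<in> subtree v \<Longrightarrow> depth v \<le> depth u"
  by (induction rule: subtree.induct) (auto simp: depth_par)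

lemma subtree_eq: "subtree v = insert v (\<Union>c\<in>children v. subtree c)"
proof (intro equalityI subsetI)
  fix u assume "u \<in> subtree v"
  then show "u \<in> insert v (\<Union>c\<in>children v. subtree c)"
  proof induction
    case (child u)
    then show ?case
      by (cases "par u = v") (auto simp: children_def intro: subtree.intros)
  qed simp
next
  fix u assume "u \<in> insert v (\<Union>c\<in>children v. subtree c)"
  then consider "u = v" | c where "c \<in> children v" "u \<in> subtree c" by blast
  then show "u \<in> subtree v"
  proof cases
    case 2
    from 2(2,1) show ?thesis
      by induction (auto simp: children_def intro: subtree.intros)
  qed (simp add: subtree.root)
qed

text \<open>Parents are unique, so a common descendant would place one sibling inside the subtree of
  the other. Then \<open>v\<close> would lie there too, although it has smaller depth.\<close>

lemma subtree_disjoint: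
  assumes "c \<in> children v" "d \<in> children v" "u \<in> subtree c" "u \<in> subtree d"
  shows "c = d"
  using assms(3,4)
proof induction
  case root
  then show ?case
    using assms(1,2) depth_child subtree_depth[of "par c" d]
    by (cases rule: subtree.cases) (auto simp: children_def)
next
  case (child u)
  from child(5) show ?case
  proof cases
    case root
    then show ?thesis
      using child(3) assms(1,2) depth_child[of _ v] subtree_depth[of "par d" c]
      by (auto simp: children_def)
  qed (use child in auto)
qed

lemma root_notin_subtree_child: "c \<in> children v \<Longrightarrow> v \<notin> subtree c"
  using depth_child subtree_depth by fastforce

lemma verts_subset_subtree_root: "verts G \<subseteq> subtree r"
proof
  fix v assume "v \<in> verts G"
  then show "v \<in> subtree r"
  proof (induction "depth v" arbitrary: v)
    case (Suc n)
    then show ?case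
      using depth_par[of v] par_in_verts[of v] by (cases "v = r") (auto intro: subtree.intros)
  qed (use depth_par subtree.root in fastforce)
qed

section \<open>Counting guards in subtrees\<close>

lemma card_Int_subtree:
  assumes "finite X"
  shows "card (X \<inter> subtree v) = of_bool (v \<in> X) + (\<Sum>c\<in>children v. card (X \<inter> subtree c))"
proof -
  have "X \<inter> subtree v = (X \<inter> {v}) \<union> (\<Union>c\<in>children v. X \<inter> subtree c)"
    by (subst subtree_eq) blast
  moreover have "(X \<inter> {v}) \<inter> (\<Union>c\<in>children v. X \<inter> subtree c) = {}"
    using root_notin_subtree_child by auto
  moreover have "card (\<Union>c\<in>children v. X \<inter> subtree c) = (\<Sum>c\<in>children v. card (X \<inter> subtree c))"
    using assms subtree_disjoint by (intro card_UN_disjoint) auto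
  ultimately show ?thesis
    using assms by (simp add: card_Un_disjoint)
qed

text \<open>The only edge into the subtree of \<open>c\<close> from outside starts at
  \<open>v\<close>. With \<open>v\<close> unguarded no guard can enter, though guards may
  leave.\<close>

lemma guard_move_card_subtree:
  assumes move: "guard_move G C C'" and "finite C" and c: "c \<in> children v" and "v \<notin> C"
  shows "card (C' \<inter> subtree c) \<le> card (C \<inter> subtree c)"
proof -
  obtain f where f: "inj_on f C" "f ` C = C'" "\<And>g. g \<in> C \<Longrightarrow> f g = g \<or> g \<rightarrow>\<^bsub>G\<^esub> f g"
    using move unfolding guard_move_def by blast
  have "g \<in> subtree c" if "g \<in> C" "f g \<in> subtree c" for g
  proof (rule ccontr)
    assume "g \<notin> subtree c"
    with that f(3)[of g] have "g \<rightarrow>\<^bsub>G\<^esub> f g" by auto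
    moreover from this have "g \<in> verts G" by (rule adj_in_verts)
    ultimately have "par (f g) = g"
      using adj_cases[of g "f g"] \<open>g \<notin> subtree c\<close> that(2) by (auto intro: subtree.child)
    from that(2) show False
      by cases (use \<open>par (f g) = g\<close> \<open>g \<notin> subtree c\<close> that(1) c \<open>v \<notin> C\<close> in \<open>auto simp: children_def\<close>)
  qed
  then have "C' \<inter> subtree c \<subseteq> f ` (C \<inter> subtree c)"
    using f(2) by auto
  then show ?thesis
    using \<open>finite C\<close> by (meson card_image_le card_mono finite_Int finite_imageI le_trans)
qed

section \<open>Loose vertices\<close>

text \<open>Well-founded recursion from the leaves, which are loose themselves;
  \<open>loose_iff\<close> is the unfolded equation.\<close>

definition loose :: "'a \<Rightarrow> bool" where
  "loose = wfrec {(c, v). c \<in> children v} (\<lambda>L v. card {c \<in> children v. L c} \<noteq> 1)"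

definition loose_children :: "'a \<Rightarrow> 'a set" where
  "loose_children v = {c \<in> children v. loose c}"

lemma loose_iff: "loose v \<longleftrightarrow> card (loose_children v) \<noteq> 1"
proof -
  have "{c \<in> children v. cut loose {(c, v). c \<in> children v} v c} = loose_children v"
    by (auto simp: loose_children_def cut_def)
  then show ?thesis
    using def_wfrec[OF eq_reflection[OF loose_def] wf_children, of v] by simp
qed

lemma finite_loose_children [simp]: "finite (loose_children v)"
  by (simp add: loose_children_def)

lemma loose_childrenD: "c \<in> loose_children v \<Longrightarrow> c \<in> children v" "c \<in> loose_children v \<Longrightarrow> loose c"
  by (simp_all add: loose_children_def)

definition required :: "'a set" where
  "required = {v \<in> verts G. loose_children v \<noteq> {}}"

lemma finite_required [simp]: "finite required"
  by (simp add: required_def)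

section \<open>Excess of guards and the attacker's induction\<close>

definition excess :: "'a set \<Rightarrow> 'a \<Rightarrow> int" where
  "excess C v = int (card (C \<inter> subtree v)) - int (card (required \<inter> subtree v))"

lemma excess_eq:
  assumes "finite C" "v \<in> verts G"
  shows "excess C v = of_bool (v \<in> C) - of_bool (loose_children v \<noteq> {}) + (\<Sum>c\<in>children v. excess C c)"
  using assms card_Int_subtree[of C v] card_Int_subtree[of required v]
  by (simp add: excess_def sum_subtractf required_def)

lemma excess_mono_if_parent_empty:
  assumes "guard_move G C C'" "finite C" "c \<in> children v" "v \<notin> C"
  shows "excess C' c \<le> excess C c"
  using guard_move_card_subtree[OF assms] by (simp add: excess_def)

lemma forced_win_if_child_forced_win:
  assumes "c \<in> children v" "forced_win G (height - depth c) C"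
  shows "forced_win G (height - depth v) C"
  using assms(2) by (rule forced_win_mono) (simp add: depth_child[OF assms(1)])

text \<open>While \<open>v\<close> is unguarded the reply cannot raise the excess below
  \<open>c\<close>. The turn spent is paid for by \<open>c\<close> being one level deeper than
  \<open>v\<close>.\<close>

lemma forced_win_if_attack_child:
  assumes "C \<subseteq> verts G" "c \<in> children v" "v \<notin> C" "excess C c \<le> 0" "a \<in> verts G"
    and win: "\<And>C'. C' \<subseteq> verts G \<Longrightarrow> a \<in> C' \<Longrightarrow> excess C' c \<le> 0 \<Longrightarrow>
      forced_win G (height - depth c) C'"
  shows "forced_win G (height - depth v) C"
proof -
  have "forced_win G (height - depth c) C'" if "guard_move G C C'" "a \<in> C'" for C'
  proof (rule win)
    show "C' \<subseteq> verts G"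
      using guard_move_subset_verts[OF wf_digraph that(1) assms(1)] .
    have "finite C"
      using assms(1) finite_verts finite_subset by blast
    from excess_mono_if_parent_empty[OF that(1) this assms(2,3)]
    show "excess C' c \<le> 0"
      using assms(4) by simp
  qed fact
  then have "forced_win G (Suc (height - depth c)) C"
    using assms(5) by auto
  moreover have "Suc (height - depth c) = height - depth v"
    using depth_child[OF assms(2)] depth_le_height[OF children_in_verts[OF assms(2)]] by simp
  ultimately show ?thesis by simp
qed

text \<open>
  In the second part, the vertex \<open>a\<close> lies at the bottom of a chain of loose descendants of \<open>v\<close>. If
  \<open>v\<close> has two loose children \<open>c, d\<close> and \<open>a\<close> belongs to \<open>c\<close>, then excess \<open>\<le> 0\<close> at \<open>v\<close> leaves \<open>v\<close>
  unguarded and no surplus at \<open>d\<close>, so that \<open>d\<close> can be attacked next.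
\<close>

lemma forced_win_subtree:
  assumes "v \<in> verts G"
  shows "(\<forall>C. C \<subseteq> verts G \<and> excess C v < 0 \<longrightarrow> forced_win G (height - depth v) C) \<and>
    (loose v \<longrightarrow> (\<exists>a\<in>verts G. \<forall>C. C \<subseteq> verts G \<and> a \<in> C \<and> excess C v \<le> 0 \<longrightarrow>
      forced_win G (height - depth v) C))"
  using wf_children assms
proof (induction v rule: wf_induct_rule)
  case (less v)
  have child_neg: "forced_win G (height - depth v) C"
    if "C \<subseteq> verts G" "c \<in> children v" "excess C c < 0" for C c
    using that less children_in_verts[of c v] forced_win_if_child_forced_win by blast
  define att where "att c a \<longleftrightarrow> a \<in> verts G \<and> (\<forall>C. C \<subseteq> verts G \<and> a \<in> C \<and> excess C c \<le> 0 \<longrightarrow>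
      forced_win G (height - depth c) C)" for c a
  have ex_att: "\<exists>a. att c a" if "c \<in> loose_children v" for c
    using less(1)[of c] loose_childrenD[OF that] children_in_verts[of c v] unfolding att_def by blast
  have child_attack: "forced_win G (height - depth v) C"
    if "C \<subseteq> verts G" "c \<in> loose_children v" "v \<notin> C" "excess C c \<le> 0" for C c
    using ex_att[OF that(2)] forced_win_if_attack_child[OF that(1) loose_childrenD(1)[OF that(2)] that(3,4)]
    unfolding att_def by blast
  have fin: "finite C" if "C \<subseteq> verts G" for C
    using that finite_verts finite_subset by blast
  note eq = excess_eq[OF fin less(2)]
  have P: "forced_win G (height - depth v) C" if C: "C \<subseteq> verts G" and neg: "excess C v < 0" for C
  \<comment> \<open>If no child has negative excess, the deficit must come from \<open>v\<close>
    itself: it is unguarded, has a loose child, and all children have excess exactly 0.\<close>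
  proof (cases "\<exists>c\<in>children v. excess C c < 0")
    case False
    then have nonneg: "\<And>c. c \<in> children v \<Longrightarrow> 0 \<le> excess C c" by force
    then have "0 \<le> (\<Sum>c\<in>children v. excess C c)" by (rule sum_nonneg)
    with neg eq[OF C] have *: "v \<notin> C" "loose_children v \<noteq> {}" "(\<Sum>c\<in>children v. excess C c) = 0"
      by (auto simp: of_bool_def split: if_splits)
    then obtain c where c: "c \<in> loose_children v" by blast
    moreover have "excess C c = 0"
      using *(3) nonneg loose_childrenD(1)[OF c] by (simp add: sum_nonneg_eq_0_iff)
    ultimately show ?thesis
      using child_attack C *(1) by simp
  qed (use child_neg C in blast)
  have Q: "\<exists>a\<in>verts G. \<forall>C. C \<subseteq> verts G \<and> a \<in> C \<and> excess C v \<le> 0 \<longrightarrow>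
      forced_win G (height - depth v) C" if "loose v"
  proof (cases "loose_children v = {}")
    case True
    \<comment> \<open>Here the attacked vertex is \<open>v\<close>: its guard counts +1 and no
      requirement at \<open>v\<close> offsets it, so some child has negative excess.\<close>
    have "forced_win G (height - depth v) C" if C: "C \<subseteq> verts G" "v \<in> C" "excess C v \<le> 0" for C
    proof -
      have "(\<Sum>c\<in>children v. excess C c) < 0"
        using C(2,3) eq[OF C(1)] True by simp
      then obtain c where "c \<in> children v" "excess C c < 0"
        by (meson not_le sum_nonneg)
      with child_neg C(1) show ?thesis by blast
    qed
    with less(2) show ?thesis by blast
  next
    case False
    moreover have "card (loose_children v) \<noteq> 1"
      using that loose_iff by auto
    ultimately obtain c d where cd: "c \<in> loose_children v" "d \<in> loose_children v" "c \<noteq> d"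
      by (metis is_singletonI' is_singleton_altdef)
    obtain a where a: "att c a" using ex_att[OF cd(1)] by blast
    have "forced_win G (height - depth v) C" if C: "C \<subseteq> verts G" "a \<in> C" "excess C v \<le> 0" for C
    proof -
      consider (neg) e where "e \<in> children v" "excess C e < 0" | (c) "excess C c \<le> 0"
        | (pos) "\<And>e. e \<in> children v \<Longrightarrow> 0 \<le> excess C e" "0 < excess C c" by force
      then show ?thesis
      proof cases
        case neg
        with child_neg C show ?thesis by blast
      next
        case c
        with a C have "forced_win G (height - depth c) C" by (simp add: att_def)
        then show ?thesis by (rule forced_win_if_child_forced_win[OF loose_childrenD(1)[OF cd(1)]])
      next
        case pos
        have "(\<Sum>e\<in>{c, d}. excess C e) \<le> (\<Sum>e\<in>children v. excess C e)"
          using pos(1) cd loose_childrenD(1) by (intro sum_mono2) auto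
        then have "excess C c + excess C d \<le> (\<Sum>e\<in>children v. excess C e)"
          using cd(3) by simp
        with pos(2) pos(1)[OF loose_childrenD(1)[OF cd(2)]] C(3) eq[OF C(1)] False
        have "v \<notin> C" "excess C d \<le> 0"
          by (auto simp: of_bool_def split: if_splits)
        then show ?thesis using child_attack C(1) cd(2) by blast
      qed
    qed
    with a show ?thesis unfolding att_def by blast
  qed
  from P Q show ?case by blast
qed

text \<open>Rooting at a leaf matters here: the root has at most one child, and exactly one loose
  child would contradict being loose.\<close>

lemma root_loose_children: "loose r \<Longrightarrow> loose_children r = {}"
proof (rule ccontr)
  assume "loose r" "loose_children r \<noteq> {}"
  then obtain c where "c \<in> loose_children r" by blast
  then have "loose_children r = {c}"
    using root_children_unique loose_childrenD(1) by blast
  with \<open>loose r\<close> show False by (simp add: loose_iff)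
qed

lemma forced_win_if_few_guards:
  assumes C: "C \<subseteq> verts G" "card C < card (insert r required)" and "0 < height"
  shows "forced_win G height C"
proof -
  have excess_root: "excess X r = int (card X) - int (card required)" if "X \<subseteq> verts G" for X
  proof -
    have "X \<inter> subtree r = X" "required \<inter> subtree r = required"
      using verts_subset_subtree_root that by (auto simp: required_def)
    then show ?thesis by (simp add: excess_def)
  qed
  show ?thesis
  proof (cases "loose r")
    case False
    then have "r \<in> required"
      using root_in_verts by (auto simp: required_def loose_iff)
    then have "excess C r < 0"
      using C excess_root by (simp add: insert_absorb)
    then have "forced_win G (height - depth r) C"
      using forced_win_subtree[OF root_in_verts] C(1) by blast
    then show ?thesis by (rule forced_win_mono) simp
  next
    case True
    \<comment> \<open>Attacking \<open>r\<close> puts a guard where none is required, so the only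
      child of \<open>r\<close> inherits a deficit. Its depth is at least 1, so the win below it
      fits into the turns left.\<close>
    have "forced_win G (height - 1) C'" if "guard_move G C C'" "r \<in> C'" for C'
    proof -
      have C': "C' \<subseteq> verts G"
        using guard_move_subset_verts[OF wf_digraph that(1) C(1)] .
      then have "finite C'" using finite_verts finite_subset by blast
      have "card C \<le> card required"
        using C(2) by (simp add: card_insert_if split: if_splits)
      then have "excess C' r \<le> 0"
        using excess_root[OF C'] guard_move_card[OF that(1)] by simp
      with excess_eq[OF \<open>finite C'\<close> root_in_verts] root_loose_children[OF True] that(2)
      have "(\<Sum>c\<in>children r. excess C' c) < 0" by simp
      then obtain c where c: "c \<in> children r" "excess C' c < 0"
        by (meson not_le sum_nonneg)
      then have "forced_win G (height - depth c) C'"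
        using forced_win_subtree[OF children_in_verts[OF c(1)]] C' by blast
      then show ?thesis
        by (rule forced_win_mono) (simp add: depth_child[OF c(1)])
    qed
    then have "forced_win G (Suc (height - 1)) C"
      using root_in_verts by auto
    with \<open>0 < height\<close> show ?thesis by (simp del: forced_win.simps)
  qed
qed

section \<open>The defender's colonies\<close>

definition inner :: "'a set" where
  "inner = {v \<in> verts G. 2 \<le> card (loose_children v)}"

text \<open>Each colony is named by its topmost vertex; these are the vertices at which the
  recursion for \<open>colony\<close> stops.\<close>

definition tops :: "'a set" where
  "tops = insert r {v \<in> verts G. \<not> loose v}"

definition colony :: "'a \<Rightarrow> 'a" where
  "colony = wfrec (measure depth) (\<lambda>col v. if v = r \<or> \<not> loose v then v else col (par v))"

lemma colony_eq:
  assumes "v \<in> verts G"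
  shows "colony v = (if v = r \<or> \<not> loose v then v else colony (par v))"
  using def_wfrec[OF eq_reflection[OF colony_def] wf_measure, of v] depth_par[OF assms]
  by (simp add: cut_def)

lemma loose_innerI: "v \<in> verts G \<Longrightarrow> loose v \<Longrightarrow> c \<in> loose_children v \<Longrightarrow> v \<in> inner"
  using card_gt_0_iff[of "loose_children v"] by (fastforce simp: inner_def loose_iff)

text \<open>Links the two sides: the set whose size bounds the attacker's win is the guards on
  \<open>inner\<close> plus one guard per colony.\<close>

lemma insert_root_required: "insert r required = inner \<union> tops"
proof -
  have "v \<in> required \<longleftrightarrow> v \<in> inner \<or> \<not> loose v" if "v \<in> verts G" for v
    using that loose_innerI[of v] by (auto simp: required_def loose_iff inner_def)
  then show ?thesis
    using root_in_verts by (auto simp: required_def inner_def tops_def)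
qed

lemma tops_notin_inner: "t \<in> tops \<Longrightarrow> t \<notin> inner"
  using root_loose_children by (auto simp: tops_def inner_def loose_iff)

lemma tops_in_verts: "t \<in> tops \<Longrightarrow> t \<in> verts G"
  using root_in_verts by (auto simp: tops_def)

lemma colony_top: "t \<in> tops \<Longrightarrow> colony t = t"
  using colony_eq[OF tops_in_verts] by (auto simp: tops_def)

lemma colony_in_tops: "v \<in> verts G \<Longrightarrow> colony v \<in> tops"
proof (induction "depth v" arbitrary: v rule: less_induct)
  case less
  show ?case
  proof (cases "v = r \<or> \<not> loose v")
    case True
    with less(2) show ?thesis by (auto simp: colony_eq tops_def)
  next
    case False
    with less show ?thesis by (simp add: colony_eq depth_par par_in_verts)
  qed
qed

text \<open>Each loose parent met on the climb has a loose child, hence at least two, and so lies in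
  \<open>inner\<close>. The climb ends just below the top.\<close>

lemma loose_path_to_top_child:
  assumes "v \<in> verts G" "loose v" "v \<noteq> r"
  shows "\<exists>c\<in>loose_children (colony v). (\<lambda>a b. a \<rightarrow>\<^bsub>G\<^esub> b \<and> b \<in> inner)\<^sup>*\<^sup>* v c"
  using assms
proof (induction "depth v" arbitrary: v rule: less_induct)
  case less
  let ?p = "par v"
  have p: "?p \<in> verts G" "v \<rightarrow>\<^bsub>G\<^esub> ?p" "v \<in> loose_children ?p" "colony v = colony ?p" "depth ?p < depth v"
    using less.prems par_in_verts par_adj depth_par colony_eq by (auto simp: loose_children_def children_def)
  show ?case
  proof (cases "?p = r \<or> \<not> loose ?p")
    case True
    then have "colony v = ?p" using p(1,4) colony_eq by auto
    with p(3) show ?thesis by auto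
  next
    case False
    then obtain c where "c \<in> loose_children (colony v)" "(\<lambda>a b. a \<rightarrow>\<^bsub>G\<^esub> b \<and> b \<in> inner)\<^sup>*\<^sup>* ?p c"
      using less(1)[OF p(5)] p(1,4) by auto
    moreover have "?p \<in> inner"
      using False p loose_innerI by blast
    ultimately show ?thesis
      using p(2) by (metis (mono_tags, lifting) converse_rtranclp_into_rtranclp)
  qed
qed

text \<open>A top that is not loose has a unique loose child \<open>c\<close>, and every other
  vertex of the colony reaches \<open>c\<close> through \<open>inner\<close>. The climb from
  \<open>x\<close> is joined at \<open>c\<close> with the reversed climb from
  \<open>y\<close>.\<close>

lemma colony_path:
  assumes x: "x \<in> verts G" "x \<notin> inner" and y: "y \<in> verts G" "y \<notin> inner"
    and col: "colony x = colony y"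
  shows "(\<lambda>a b. a \<rightarrow>\<^bsub>G\<^esub> b \<and> a \<in> insert x inner \<and> b \<in> insert y inner)\<^sup>*\<^sup>* x y"
proof (cases "x = y")
  case False
  obtain t where tx: "colony x = t" and ty: "colony y = t" using col by simp
  let ?U = "\<lambda>a b. a \<rightarrow>\<^bsub>G\<^esub> b \<and> b \<in> inner"
  let ?S = "\<lambda>a b. a \<rightarrow>\<^bsub>G\<^esub> b \<and> a \<in> insert x inner \<and> b \<in> insert y inner"
  have up: "\<exists>c\<in>loose_children t. ?U\<^sup>*\<^sup>* v c" if "v \<in> verts G" "colony v = t" "v \<noteq> t" for v
  proof -
    have "loose v" "v \<noteq> r"
      using colony_eq[OF that(1)] that(2,3) by (auto split: if_splits)
    with loose_path_to_top_child[OF that(1)] that(2) show ?thesis by simp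
  qed
  have t: "t \<in> tops" using colony_in_tops[OF x(1)] tx by simp
  have "\<exists>c. c \<in> loose_children t"
    using up[OF x(1) tx] up[OF y(1) ty] False by blast
  \<comment> \<open>A loose top can only be \<open>r\<close>, and a loose root has no loose
    child.\<close>
  then have "\<not> loose t"
    using t root_loose_children by (auto simp: tops_def)
  then obtain c where c: "loose_children t = {c}"
    by (auto simp: loose_iff card_1_singleton_iff)
  then have "c \<in> children t" using loose_childrenD by blast
  then have ct: "c \<rightarrow>\<^bsub>G\<^esub> t" "t \<rightarrow>\<^bsub>G\<^esub> c"
    using par_adj graph_symmetric by (auto simp: children_def)
  have up': "?U\<^sup>*\<^sup>* v c" if "v \<in> verts G" "colony v = t" "v \<noteq> t" for v
    using up[OF that] c by simp
  have down: "?S\<^sup>*\<^sup>* c y" if "y \<noteq> t"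
  proof -
    have "?S\<^sup>*\<^sup>* b y \<and> b \<in> insert y inner" if "?U\<^sup>*\<^sup>* y b" for b
      using that
    proof induction
      case (step a b)
      then have "?S b a" using graph_symmetric by auto
      with step show ?case by (metis (no_types, lifting) converse_rtranclp_into_rtranclp insertI2)
    qed simp
    then show ?thesis using up'[OF y(1) ty that] by simp
  qed
  have climb: "?S\<^sup>*\<^sup>* x c" if "x \<noteq> t"
  proof -
    have "?S\<^sup>*\<^sup>* x b \<and> b \<in> insert x inner" if "?U\<^sup>*\<^sup>* x b" for b
      using that
    proof induction
      case (step a b)
      then have "?S a b" by auto
      with step show ?case by (metis (no_types, lifting) rtranclp.rtrancl_into_rtrancl insertI2)
    qed simp
    then show ?thesis using up'[OF x(1) tx that] by simp
  qed
  \<comment> \<open>This makes the edge between \<open>c\<close> and \<open>t\<close> admissible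
    when one endpoint of the path is \<open>t\<close> itself.\<close>
  have c_inner: "c = v \<or> c \<in> inner" if "v \<in> verts G" "colony v = t" "v \<noteq> t" for v
    using up'[OF that] by (cases rule: rtranclp.cases) auto
  consider "x \<noteq> t" "y \<noteq> t" | "x = t" "y \<noteq> t" | "x \<noteq> t" "y = t" using False by blast
  then show ?thesis
  proof cases
    case 1
    with climb down show ?thesis by (meson rtranclp_trans)
  next
    case 2
    then have "?S x c" using ct(2) c_inner[OF y(1) ty] by auto
    with down[OF 2(2)] show ?thesis by (rule converse_rtranclp_into_rtranclp[rotated])
  next
    case 3
    then have "?S c y" using ct(1) c_inner[OF x(1) tx] by auto
    with climb[OF 3(1)] show ?thesis by (rule rtranclp.rtrancl_into_rtrancl)
  qed
qed simp

section \<open>The defender's strategy\<close>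

definition colony_guards :: "('a \<Rightarrow> 'a) \<Rightarrow> bool" where
  "colony_guards s \<longleftrightarrow> (\<forall>t\<in>tops. s t \<in> verts G \<and> s t \<notin> inner \<and> colony (s t) = t)"

definition respond :: "('a \<Rightarrow> 'a) \<Rightarrow> 'a \<Rightarrow> ('a \<Rightarrow> 'a)" where
  "respond s y = (if y \<in> inner then s else s(colony y := y))"

lemma colony_guards_respond: "colony_guards s \<Longrightarrow> y \<in> verts G \<Longrightarrow> colony_guards (respond s y)"
  by (auto simp: colony_guards_def respond_def)

lemma guard_move_respond:
  assumes s: "colony_guards s" and y: "y \<in> verts G"
  shows "guard_move G (inner \<union> s ` tops) (inner \<union> respond s y ` tops)"
proof (cases "y \<in> inner")
  case False
  let ?t = "colony y" and ?O = "s ` (tops - {colony y})"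
  have t: "?t \<in> tops" using colony_in_tops[OF y] .
  then have x: "s ?t \<in> verts G" "s ?t \<notin> inner" "colony (s ?t) = ?t"
    using s by (auto simp: colony_guards_def)
  have "guard_move G (insert (s ?t) inner) (insert y inner)"
    using colony_path[OF x(1,2) y False x(3)] x(2) False by (rule guard_move_shift)
  \<comment> \<open>Guards of other colonies avoid \<open>inner\<close>, and their
    \<open>colony\<close> value separates them from \<open>y\<close> and
    \<open>s ?t\<close>.\<close>
  moreover have "insert (s ?t) inner \<inter> ?O = {}" "insert y inner \<inter> ?O = {}"
    using s x by (auto simp: colony_guards_def)
  ultimately have "guard_move G (insert (s ?t) inner \<union> ?O) (insert y inner \<union> ?O)"
    by (intro guard_move_Un guard_move_refl)
  moreover have "inner \<union> s ` tops = insert (s ?t) inner \<union> ?O"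
    using t by auto
  moreover have "inner \<union> respond s y ` tops = insert y inner \<union> ?O"
    using t False by (auto simp: respond_def)
  ultimately show ?thesis by simp
qed (simp add: respond_def guard_move_refl)

lemma respond_defends: "y \<in> verts G \<Longrightarrow> y \<in> inner \<union> respond s y ` tops"
  using colony_in_tops[of y] by (auto simp: respond_def image_iff)

lemma m_eternal_dominating_required: "m_eternal_dominating G (insert r required)"
proof -
  \<comment> \<open>Starting from \<open>id\<close> puts each colony's guard on its top.\<close>
  define \<tau> where "\<tau> as = inner \<union> foldl respond id as ` tops" for as
  have "colony_guards (foldl respond id as)" if "as \<in> lists (verts G)" for as
    using that
  proof (induction as rule: rev_induct)
    case Nil
    then show ?case
      using tops_in_verts tops_notin_inner colony_top by (simp add: colony_guards_def)
  qed (simp add: colony_guards_respond)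
  then have "\<forall>as \<in> lists (verts G). \<forall>v \<in> verts G.
      guard_move G (\<tau> as) (\<tau> (as @ [v])) \<and> v \<in> \<tau> (as @ [v])"
    using guard_move_respond respond_defends unfolding \<tau>_def by simp
  moreover have "\<tau> [] = insert r required"
    by (simp add: \<tau>_def insert_root_required)
  moreover have "insert r required \<subseteq> verts G"
    using root_in_verts by (auto simp: required_def)
  ultimately show ?thesis
    unfolding m_eternal_dominating_def by blast
qed

lemma m_eternal_domination_number_le: "m_eternal_domination_number G \<le> card (insert r required)"
  unfolding m_eternal_domination_number_def
  using m_eternal_dominating_required by (intro Least_le) blast

end

section \<open>Rooting a tree at a leaf\<close>

context wf_digraph
begin

lemma graph_dist_le: "awalk u p v \<Longrightarrow> graph_dist G u v \<le> length p"
  unfolding graph_dist_def by (rule Least_le) blast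

lemma obtain_shortest_awalk:
  assumes "u \<rightarrow>\<^sup>*\<^bsub>G\<^esub> v"
  obtains p where "awalk u p v" "length p = graph_dist G u v"
  using assms LeastI_ex[of "\<lambda>n. \<exists>p. awalk u p v \<and> length p = n"]
  unfolding reachable_awalk graph_dist_def by blast

lemma graph_dist_eq_0: "u \<rightarrow>\<^sup>*\<^bsub>G\<^esub> v \<Longrightarrow> graph_dist G u v = 0 \<Longrightarrow> v = u"
  using obtain_shortest_awalk by (metis awalk_empty_ends length_0_conv)

lemma graph_dist_pred:
  assumes "r \<rightarrow>\<^sup>*\<^bsub>G\<^esub> v" "v \<noteq> r"
  shows "\<exists>u. u \<rightarrow>\<^bsub>G\<^esub> v \<and> r \<rightarrow>\<^sup>*\<^bsub>G\<^esub> u \<and> graph_dist G r v = Suc (graph_dist G r u)"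
proof -
  obtain p where p: "awalk r p v" "length p = graph_dist G r v"
    using obtain_shortest_awalk[OF assms(1)] .
  with assms(2) obtain q e where q: "p = q @ [e]"
    by (cases p rule: rev_cases) (auto simp: awalk_Nil_iff)
  let ?u = "tail G e"
  have rq: "awalk r q ?u" and e: "e \<in> arcs G" "head G e = v"
    using p(1) unfolding q by (auto simp: awalk_simps awalk_append_iff)
  then have reach: "r \<rightarrow>\<^sup>*\<^bsub>G\<^esub> ?u" by (blast intro: reachable_awalkI)
  obtain q' where q': "awalk r q' ?u" "length q' = graph_dist G r ?u"
    using obtain_shortest_awalk[OF reach] .
  then have "awalk r (q' @ [e]) v"
    using e arc_implies_awalk[of e] by (metis awalk_appendI)
  from graph_dist_le[OF this] have "graph_dist G r v \<le> Suc (graph_dist G r ?u)"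
    using q'(2) by simp
  moreover have "Suc (graph_dist G r ?u) \<le> graph_dist G r v"
    using graph_dist_le[OF rq] p(2) unfolding q by simp
  moreover have "?u \<rightarrow>\<^bsub>G\<^esub> v"
    using e in_arcs_imp_in_arcs_ends[of e] by simp
  ultimately show ?thesis using reach by (intro exI[of _ ?u]) simp
qed

end

context graph
begin

text \<open>A simple path from \<open>a\<close> to \<open>b\<close> avoiding \<open>v\<close> closes
  up through \<open>v\<close>; it is nonempty because \<open>a\<close> and \<open>b\<close> differ,
  which gives length 3.\<close>

lemma cycle_if_neighbours_connected:
  assumes "v \<rightarrow>\<^bsub>G\<^esub> a" "v \<rightarrow>\<^bsub>G\<^esub> b" "a \<noteq> b" "a \<rightarrow>\<^sup>*\<^bsub>del_vert v\<^esub> b"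
  shows "\<exists>p. cycle p \<and> 3 \<le> length p"
proof -
  interpret D: wf_digraph "del_vert v" by (rule wf_digraph_del_vert)
  obtain p where p: "D.apath a p b"
    using assms(4) D.reachable_apath by blast
  then have D: "D.awalk a p b" by (rule D.awalkI_apath)
  have pG: "apath a p b"
    using p subgraph_del_vert subgraph_apath_imp_apath by blast
  have "v \<notin> set (awalk_verts a p)"
  proof
    assume "v \<in> set (awalk_verts a p)"
    moreover have "awalk_verts a p = D.awalk_verts a p"
      by (induction p arbitrary: a) (simp_all add: D.awalk_verts.simps awalk_verts.simps del_vert_simps)
    ultimately show False
      using D.awalk_verts_in_verts[of a p v] D by (auto simp: D.awalk_def del_vert_simps)
  qed
  moreover obtain e where e: "e \<in> arcs G" "tail G e = v" "head G e = a"
    using assms(1) by (auto simp: arcs_ends_conv)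
  moreover obtain f where f: "f \<in> arcs G" "tail G f = b" "head G f = v"
    using graph_symmetric[OF assms(2)] by (auto simp: arcs_ends_conv)
  ultimately have "awalk v (e # p @ [f]) v" "distinct (tl (awalk_verts v (e # p @ [f])))"
    using pG by (auto simp: apath_def awalk_simps awalk_verts_append)
  moreover have "p \<noteq> []"
    using assms(3) pG by (auto simp: apath_Nil_iff)
  then have "3 \<le> length (e # p @ [f])"
    by (cases p) auto
  ultimately show ?thesis unfolding cycle_def by blast
qed

end

locale tree_graph = graph G for G :: "('a, 'b) pre_digraph" (structure) +
  assumes connected: "connected G"
    and no_cycle: "\<not> (\<exists>p. cycle p \<and> 3 \<le> length p)"
begin

lemma reachable: "u \<in> verts G \<Longrightarrow> v \<in> verts G \<Longrightarrow> u \<rightarrow>\<^sup>*\<^bsub>G\<^esub> v"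
  using connected symmetric_connected_imp_strongly_connected[OF sym_arcs] strongly_connected_def by blast

text \<open>From a vertex other than \<open>v\<close> and no farther from \<open>r\<close>,
  descending along shortest walks never meets \<open>v\<close>. So \<open>a\<close> and
  \<open>b\<close> are joined off \<open>v\<close>, which would close a cycle. Equal distances are
  included, so this also excludes edges within a level.\<close>

lemma lower_neighbour_unique:
  assumes "r \<in> verts G" and a: "v \<rightarrow>\<^bsub>G\<^esub> a" "graph_dist G r a \<le> graph_dist G r v"
    and b: "v \<rightarrow>\<^bsub>G\<^esub> b" "graph_dist G r b \<le> graph_dist G r v"
  shows "a = b"
proof (rule ccontr)
  assume "a \<noteq> b"
  interpret D: wf_digraph "del_vert v" by (rule wf_digraph_del_vert)
  have D_adj: "x \<rightarrow>\<^bsub>del_vert v\<^esub> y" if "x \<rightarrow>\<^bsub>G\<^esub> y" "x \<noteq> v" "y \<noteq> v" for x y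
    using that by (auto simp: arcs_ends_conv del_vert_simps)
  have "r \<rightarrow>\<^sup>*\<^bsub>del_vert v\<^esub> x \<and> x \<rightarrow>\<^sup>*\<^bsub>del_vert v\<^esub> r"
    if "x \<in> verts G" "x \<noteq> v" "graph_dist G r x \<le> graph_dist G r v" for x
    using that
  proof (induction "graph_dist G r x" arbitrary: x rule: less_induct)
    case less
    show ?case
    proof (cases "x = r")
      case True
      with less(2,3) show ?thesis by (auto simp: del_vert_simps)
    next
      case False
      then obtain u where u: "u \<rightarrow>\<^bsub>G\<^esub> x" "graph_dist G r x = Suc (graph_dist G r u)"
        using graph_dist_pred reachable assms(1) less(2) by blast
      with less(4) have "u \<noteq> v" by auto
      with u less have "r \<rightarrow>\<^sup>*\<^bsub>del_vert v\<^esub> u \<and> u \<rightarrow>\<^sup>*\<^bsub>del_vert v\<^esub> r"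
        using adj_in_verts(1) by auto
      then show ?thesis
        using D_adj[OF u(1) \<open>u \<noteq> v\<close> less(3)] D_adj[OF graph_symmetric[OF u(1)] less(3) \<open>u \<noteq> v\<close>]
        by (meson D.reachable_adj_trans D.adj_reachable_trans)
    qed
  qed
  then have "a \<rightarrow>\<^sup>*\<^bsub>del_vert v\<^esub> r" "r \<rightarrow>\<^sup>*\<^bsub>del_vert v\<^esub> b"
    using a b adj_in_verts(2) adj_not_same by blast+
  then have "a \<rightarrow>\<^sup>*\<^bsub>del_vert v\<^esub> b"
    by (rule D.reachable_trans)
  with cycle_if_neighbours_connected a(1) b(1) \<open>a \<noteq> b\<close> no_cycle show False by blast
qed

lemma leaf_rooted_tree:
  obtains r par where "leaf_rooted_tree G r par (graph_dist G r)"
proof -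
  obtain r0 where r0: "r0 \<in> verts G"
    using connected by (auto simp: connected_def strongly_connected_def)
  \<comment> \<open>The root is taken farthest from an arbitrary \<open>r0\<close>. All its
    neighbours are then no farther from \<open>r0\<close>, so uniqueness, applied with
    \<open>r0\<close> as base, makes it a leaf.\<close>
  have "Max (graph_dist G r0 ` verts G) \<in> graph_dist G r0 ` verts G"
    using r0 by (intro Max_in) auto
  then obtain r where r: "r \<in> verts G" "graph_dist G r0 r = Max (graph_dist G r0 ` verts G)"
    by auto
  then have far: "graph_dist G r0 v \<le> graph_dist G r0 r" if "v \<in> verts G" for v
    using that by simp
  define par where "par v = (SOME u. u \<rightarrow>\<^bsub>G\<^esub> v \<and> graph_dist G r v = Suc (graph_dist G r u))" for v
  have par: "par v \<rightarrow>\<^bsub>G\<^esub> v" "graph_dist G r v = Suc (graph_dist G r (par v))"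
    if "v \<in> verts G" "v \<noteq> r" for v
    using someI_ex[of "\<lambda>u. u \<rightarrow>\<^bsub>G\<^esub> v \<and> graph_dist G r v = Suc (graph_dist G r u)"]
      graph_dist_pred[OF reachable[OF r(1) that(1)] that(2)] unfolding par_def by blast+
  \<comment> \<open>Both \<open>v\<close> and \<open>par u\<close> are neighbours of
    \<open>u\<close> no farther from \<open>r\<close> than \<open>u\<close>, hence equal.\<close>
  have lower: "u \<noteq> r \<and> par u = v" if uv: "u \<rightarrow>\<^bsub>G\<^esub> v" and le: "graph_dist G r v \<le> graph_dist G r u" for u v
  proof -
    have "graph_dist G r r = 0"
      using graph_dist_le[of r "[]" r] r(1) by (simp add: awalk_Nil_iff)
    then have "u \<noteq> r"
      using uv le graph_dist_eq_0[OF reachable[OF r(1)]] adj_in_verts(2)[OF uv] adj_not_same by fastforce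
    moreover have "par u = v"
      using par[OF adj_in_verts(1)[OF uv] \<open>u \<noteq> r\<close>] graph_symmetric uv le r(1)
      by (intro lower_neighbour_unique[of r u]) auto
    ultimately show ?thesis by blast
  qed
  have "leaf_rooted_tree G r par (graph_dist G r)"
  proof unfold_locales
    show "u \<noteq> r \<and> par u = v \<or> v \<noteq> r \<and> par v = u" if "u \<rightarrow>\<^bsub>G\<^esub> v" for u v
      using lower[OF that] lower[OF graph_symmetric[OF that]] by linarith
    show "u = v" if "r \<rightarrow>\<^bsub>G\<^esub> u" "r \<rightarrow>\<^bsub>G\<^esub> v" for u v
      using that far adj_in_verts(2) by (intro lower_neighbour_unique[OF r0, of r]) auto
  qed (use r(1) par graph_symmetric in auto)
  then show ?thesis by (rule that)
qed

end

theorem theorem1: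
  fixes T :: "('a, 'b) pre_digraph" and C :: "'a set"
  assumes "undirected_tree T"
    and "card (verts T) \<ge> 2"
    and "C \<subseteq> verts T"
    and "card C \<le> m_eternal_domination_number T - 1"
  shows "attacker_wins_within T C (graph_diam T)"
proof -
  interpret tree_graph T
    using assms(1) by (simp add: undirected_tree_def tree_graph_def tree_graph_axioms_def)
  obtain r par where "leaf_rooted_tree T r par (graph_dist T r)"
    by (rule leaf_rooted_tree)
  then interpret R: leaf_rooted_tree T r par "graph_dist T r" .
  have "\<not> verts T \<subseteq> {r}"
    using assms(2) card_mono[of "{r}" "verts T"] by auto
  then obtain v where v: "v \<in> verts T" "v \<noteq> r" by blast
  then have "0 < R.height"
    using R.depth_par R.depth_le_height by fastforce
  \<comment> \<open>Positivity turns the bound with truncated subtraction into a strict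
    inequality.\<close>
  moreover have "0 < card (insert r R.required)"
    by (simp add: card_gt_0_iff)
  then have "card C < card (insert r R.required)"
    using assms(4) R.m_eternal_domination_number_le by simp
  ultimately have "forced_win T R.height C"
    using R.forced_win_if_few_guards assms(3) by blast
  \<comment> \<open>Depths are distances from \<open>r\<close>, so their maximum ranges over some of
    the distances that define the diameter.\<close>
  moreover have "R.height \<le> graph_diam T"
  proof -
    have "{graph_dist T u v | u v. u \<in> verts T \<and> v \<in> verts T} =
        (\<lambda>(u, v). graph_dist T u v) ` (verts T \<times> verts T)"
      by auto
    then have "finite {graph_dist T u v | u v. u \<in> verts T \<and> v \<in> verts T}"
      by simp
    then show ?thesis
      unfolding R.height_def graph_diam_def using R.root_in_verts v(1)
      by (intro Max_mono) auto
  qed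
  ultimately show ?thesis
    using forced_win_mono attacker_wins_within_if_forced_win by blast
qed

end
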